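(* Let $n$ be a positive integer and $k$ a nonnegative integer with $n \ge k$. If $G$ is $K_{2,t}$-free for $t \ge 1$ an integer and has $n-k$ vertices of degree at least $D$ and $k$ vertices of degree less than $D$, with $D > k$, then $$c(G) \ge \frac{D-k}{t}.$$
   Context: All graphs are finite, simple, undirected and connected; $G$ is a graph (of order $n$). A graph is $H$-free if it does not contain $H$ as a subgraph; $K_{2,t}$ is the complete bipartite graph with parts of sizes $2$ and $t$. Cops and Robbers on a graph $G$: in round $0$ the cops choose vertices to occupy, then the robber chooses a vertex. In each later round the cops move first and then the robber. On a move, each player moves to a neighboring vertex or stays put; any subset of the cops may move. The cops win if after finitely many rounds some cop occupies the robber's vertex; otherwise the robber wins. The cop number $c(G)$ is the minimum number of cops required to guarantee a win for the cops.
   Formalization: The formal statement assumes n > k instead of n ≥ k, since for n = k the claim fails: for G = K_1 with n = k = 1, t = 1, D = 100 all hypotheses hold but c(G) = 1 < 99. *)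

theory Defs
  imports Complex_Main "Graph_Theory.Graph_Theory"
begin

text \<open>
  Undirected simple graphs are the finite symmetric digraphs of the locale \<^locale>\<open>graph\<close>: an edge
  is a pair of opposite arcs, so \<^const>\<open>out_degree\<close> is the usual vertex degree.
\<close>

definition complete_bipartite_free :: "nat \<Rightarrow> nat \<Rightarrow> ('a, 'b) pre_digraph \<Rightarrow> bool" where
  "complete_bipartite_free m n G \<longleftrightarrow> \<not> (\<exists>H. subgraph H G \<and> complete_bipartite_digraph m n H)"

definition player_move :: "('a, 'b) pre_digraph \<Rightarrow> 'a \<Rightarrow> 'a \<Rightarrow> bool" where
  "player_move G u v \<longleftrightarrow> u \<in> verts G \<and> (v = u \<or> u \<rightarrow>\<^bsub>G\<^esub> v)"

text \<open>\<open>r i\<close> is the position of the robber at the end of round \<open>i\<close>.\<close>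

definition robber_play :: "('a, 'b) pre_digraph \<Rightarrow> (nat \<Rightarrow> 'a) \<Rightarrow> bool" where
  "robber_play G r \<longleftrightarrow> r 0 \<in> verts G \<and> (\<forall>i. player_move G (r i) (r (Suc i)))"

text \<open>
  A strategy of the cops maps the robber's positions in the rounds before round \<open>i\<close> (a list of
  length \<open>i\<close>) to the list of the cops' positions in round \<open>i\<close>; the \<open>j\<close>-th entry is the position of
  the \<open>j\<close>-th cop. Since the strategy determines the cops' own past moves, this history is complete
  information.
\<close>

definition cop_positions :: "('a list \<Rightarrow> 'a list) \<Rightarrow> (nat \<Rightarrow> 'a) \<Rightarrow> nat \<Rightarrow> 'a list" where
  "cop_positions \<sigma> r i = \<sigma> (map r [0..<i])"

definition cop_strategy :: "('a, 'b) pre_digraph \<Rightarrow> nat \<Rightarrow> ('a list \<Rightarrow> 'a list) \<Rightarrow> bool" where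
  "cop_strategy G m \<sigma> \<longleftrightarrow> length (\<sigma> []) = m \<and> set (\<sigma> []) \<subseteq> verts G \<and>
     (\<forall>r i. robber_play G r \<longrightarrow>
        list_all2 (player_move G) (cop_positions \<sigma> r i) (cop_positions \<sigma> r (Suc i)))"

text \<open>
  The robber is caught if a cop shares his vertex at the end of some round \<open>i\<close>, or after the cops'
  move and before the robber's move of round \<open>Suc i\<close>. Plays are continued after a capture, which
  has no influence on the outcome.
\<close>

definition robber_caught :: "('a list \<Rightarrow> 'a list) \<Rightarrow> (nat \<Rightarrow> 'a) \<Rightarrow> bool" where
  "robber_caught \<sigma> r \<longleftrightarrow>
     (\<exists>i. r i \<in> set (cop_positions \<sigma> r i) \<or> r i \<in> set (cop_positions \<sigma> r (Suc i)))"

definition cops_can_win :: "('a, 'b) pre_digraph \<Rightarrow> nat \<Rightarrow> bool" where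
  "cops_can_win G m \<longleftrightarrow>
     (\<exists>\<sigma>. cop_strategy G m \<sigma> \<and> (\<forall>r. robber_play G r \<longrightarrow> robber_caught \<sigma> r))"

definition cop_number :: "('a, 'b) pre_digraph \<Rightarrow> nat" where
  "cop_number G = (LEAST m. cops_can_win G m)"

text \<open>The minimum is taken over a nonempty set.\<close>

lemma cops_can_win_card_verts:
  assumes "graph G"
  shows "cops_can_win G (card (verts G))"
proof -
  interpret graph G by (rule assms)
  obtain c where c: "set c = verts G" "distinct c"
    using finite_distinct_list[OF finite_verts] by (elim exE conjE)
  have "cop_strategy G (card (verts G)) (\<lambda>_. c)"
    using c distinct_card[of c]
    by (simp add: cop_strategy_def cop_positions_def list_all2_conv_all_nth player_move_def flip: c(1))
  moreover have "robber_caught (\<lambda>_. c) r" if "robber_play G r" for r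
    using that c(1) by (simp add: robber_caught_def cop_positions_def robber_play_def) blast
  ultimately show ?thesis
    unfolding cops_can_win_def by blast
qed

lemma cops_can_win_cop_number:
  assumes "graph G"
  shows "cops_can_win G (cop_number G)"
  unfolding cop_number_def using cops_can_win_card_verts[OF assms] by (rule LeastI)

end

theory Submission
  imports Defs
begin

text \<open>
  The robber can live on the set \<open>S\<close> of vertices of degree at least \<open>D\<close>. Suppose that he is at
  \<open>u \<in> S\<close>, that the cops have just moved and that none of them is at \<open>u\<close>. A cop at \<open>w \<noteq> u\<close> threatens
  at most \<open>t\<close> of the neighbours of \<open>u\<close>: possibly \<open>w\<close> itself, and the common neighbours of \<open>u\<close> and
  \<open>w\<close>, of which there are at most \<open>t - 1\<close> in a \<open>K\<^bsub>2,t\<^esub>\<close>-free graph. So \<open>m\<close> cops threaten at most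
  \<open>m * t\<close> neighbours of \<open>u\<close>, and at most \<open>k\<close> further neighbours lie outside \<open>S\<close>. If \<open>m * t + k < D\<close>
  then the robber has an unthreatened neighbour in \<open>S\<close> to go to (\<open>unthreatened_neighbour\<close>). The cops
  cannot reach him there in one move, so the situation recurs and he is never caught
  (\<open>cops_cannot_win_if_evasion_set\<close>).

  The same count provides a starting vertex: it is a neighbour of any \<open>u \<in> S\<close> that is not occupied
  at the outset. Such a \<open>u\<close> exists, because otherwise \<open>m \<ge> n - k\<close>, hence \<open>D > m * t + k \<ge> n\<close>,
  which is more than any degree.
\<close>

text \<open>
  The forbidden subgraph keeps the vertices \<open>U \<union> V\<close> and exactly the arcs between the two sides; arcs
  of \<open>G\<close> inside \<open>U\<close> or \<open>V\<close> do no harm because subgraphs need not be induced.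
\<close>

lemma not_complete_bipartite_free_if_biclique:
  assumes "graph G" and UV: "U \<subseteq> verts G" "V \<subseteq> verts G" "U \<inter> V = {}" "U \<times> V \<subseteq> arcs_ends G"
  shows "\<not> complete_bipartite_free (card U) (card V) G"
proof -
  interpret graph G by (rule assms)
  define H where "H = G\<lparr>verts := U \<union> V, arcs := {e \<in> arcs G. arc_to_ends G e \<in> U \<times> V \<union> V \<times> U}\<rparr>"
  have "V \<times> U \<subseteq> arcs_ends G"
    using UV(4) arcs_ends_symmetric[OF sym_arcs] by blast
  then have ends: "arcs_ends H = U \<times> V \<union> V \<times> U"
    using UV(4) by (auto simp: H_def arcs_ends_def arc_to_ends_def)
  have "wf_digraph H"
    by unfold_locales (auto simp: H_def arc_to_ends_def)
  then interpret H: wf_digraph H .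
  have fin: "finite (verts H)" "finite (arcs H)"
    using UV(1,2) by (auto simp: H_def intro: finite_subset[OF _ finite_verts])
  have "graph H"
  proof unfold_locales
    show "symmetric H"
      by (auto simp: symmetric_def ends sym_def)
  qed (use fin no_loops no_multi_arcs in \<open>auto simp: H_def arc_to_ends_def\<close>)
  then have "complete_bipartite_digraph (card U) (card V) H"
    unfolding complete_bipartite_digraph_def using UV(3) ends by (auto simp: H_def)
  moreover have "subgraph H G"
    using UV H.wf_digraph wf_digraph by (auto simp: subgraph_def compatible_def H_def)
  ultimately show ?thesis
    unfolding complete_bipartite_free_def by blast
qed

lemma card_common_neighbours_less:
  assumes G: "graph G" and free: "complete_bipartite_free 2 t G"
    and "u \<in> verts G" "w \<in> verts G" "u \<noteq> w"
  shows "card {v. u \<rightarrow>\<^bsub>G\<^esub> v \<and> w \<rightarrow>\<^bsub>G\<^esub> v} < t"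
proof (rule ccontr)
  interpret graph G by (rule G)
  assume "\<not> ?thesis"
  then have "t \<le> card {v. u \<rightarrow>\<^bsub>G\<^esub> v \<and> w \<rightarrow>\<^bsub>G\<^esub> v}"
    by simp
  then obtain V where V: "V \<subseteq> {v. u \<rightarrow>\<^bsub>G\<^esub> v \<and> w \<rightarrow>\<^bsub>G\<^esub> v}" "card V = t"
    by (rule obtain_subset_with_card_n)
  have "\<not> complete_bipartite_free (card {u, w}) (card V) G"
  proof (rule not_complete_bipartite_free_if_biclique[OF G])
    show "{u, w} \<subseteq> verts G"
      using assms(3,4) by simp
    show "V \<subseteq> verts G"
      using V(1) by (auto dest: adj_in_verts)
    show "{u, w} \<inter> V = {}"
      using V(1) by (auto dest: adj_not_same)
    show "{u, w} \<times> V \<subseteq> arcs_ends G"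
      using V(1) by auto
  qed
  then show False
    using free V(2) \<open>u \<noteq> w\<close> by (simp add: numeral_2_eq_2)
qed

text \<open>
  Degrees count arcs; in the absence of parallel arcs they count neighbours as well.
\<close>

lemma (in graph) card_neighbours: "card {v. u \<rightarrow>\<^bsub>G\<^esub> v} = out_degree G u"
proof -
  have "bij_betw (head G) (out_arcs G u) {v. u \<rightarrow>\<^bsub>G\<^esub> v}"
    unfolding bij_betw_def
  proof
    show "inj_on (head G) (out_arcs G u)"
      by (auto intro!: inj_onI no_multi_arcs simp: arc_to_ends_def)
  qed (auto simp: arcs_ends_conv)
  then show ?thesis
    unfolding out_degree_def by (metis bij_betw_same_card)
qed

text \<open>
  The relation \<^term>\<open>player_move G c\<close> describes the closed neighbourhood of \<open>c\<close>, that is, the vertices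
  threatened by a cop at \<open>c\<close>. Apart from \<open>c\<close> itself, its members adjacent to \<open>u\<close> are common
  neighbours of \<open>u\<close> and \<open>c\<close>, so each cop rules out at most \<open>(t - 1) + 1\<close> neighbours of \<open>u\<close>.
\<close>

lemma unthreatened_neighbour:
  assumes G: "graph G" and free: "complete_bipartite_free 2 t G"
    and u: "u \<in> verts G" "u \<notin> set C" and C: "set C \<subseteq> verts G"
    and B: "finite B" "length C * t + card B < out_degree G u"
  shows "\<exists>v. u \<rightarrow>\<^bsub>G\<^esub> v \<and> v \<notin> B \<and> (\<forall>c\<in>set C. \<not> player_move G c v)"
proof (rule ccontr)
  interpret graph G by (rule G)
  let ?N = "\<lambda>c. {v. u \<rightarrow>\<^bsub>G\<^esub> v \<and> player_move G c v}"
  assume "\<not> ?thesis"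
  then have cover: "{v. u \<rightarrow>\<^bsub>G\<^esub> v} \<subseteq> (\<Union>c\<in>set C. ?N c) \<union> B"
    by blast
  have finite_nbs: "finite {v. u \<rightarrow>\<^bsub>G\<^esub> v}"
    by (rule finite_subset[OF _ finite_verts]) auto
  have "card (?N c) \<le> t" if "c \<in> set C" for c
  proof -
    let ?W = "{v. u \<rightarrow>\<^bsub>G\<^esub> v \<and> c \<rightarrow>\<^bsub>G\<^esub> v}"
    have "finite ?W"
      using finite_nbs by (rule rev_finite_subset) blast
    have "?N c \<subseteq> insert c ?W"
      by (auto simp: player_move_def)
    with \<open>finite ?W\<close> have "card (?N c) \<le> card (insert c ?W)"
      by (intro card_mono) auto
    also have "\<dots> \<le> Suc (card ?W)"
      using \<open>finite ?W\<close> by (simp add: card_insert_if)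
    also have "\<dots> \<le> t"
      using card_common_neighbours_less[OF G free, of u c] u C that by (auto simp: Suc_le_eq)
    finally show ?thesis .
  qed
  then have "(\<Sum>c\<in>set C. card (?N c)) \<le> card (set C) * t"
    using sum_bounded_above[of "set C" "\<lambda>c. card (?N c)" t] by simp
  then have "card (\<Union>c\<in>set C. ?N c) \<le> card (set C) * t"
    using card_UN_le[of "set C" ?N] by simp
  also have "\<dots> \<le> length C * t"
    by (simp add: card_length)
  finally have "card (\<Union>c\<in>set C. ?N c) + card B \<le> length C * t + card B"
    by simp
  moreover have "finite ((\<Union>c\<in>set C. ?N c) \<union> B)"
    using B(1) finite_nbs by (auto intro: rev_finite_subset)
  then have "card {v. u \<rightarrow>\<^bsub>G\<^esub> v} \<le> card (\<Union>c\<in>set C. ?N c) + card B"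
    using card_mono[OF _ cover] card_Un_le le_trans by blast
  ultimately show False
    using B(2) card_neighbours[of u] by linarith
qed

text \<open>
  This turns a local escape rule into a whole play that defeats a given strategy of the cops. The
  robber keeps two properties after each of his moves: he is in \<open>S\<close>, and he is threatened by no cop. The second
  one prevents the cops from reaching him, and \<open>escape\<close> then restores both.
\<close>

lemma cops_cannot_win_if_evasion_set:
  assumes S: "S \<subseteq> verts G"
    and start: "\<And>C. length C = m \<Longrightarrow> set C \<subseteq> verts G \<Longrightarrow> \<exists>v\<in>S. \<forall>c\<in>set C. \<not> player_move G c v"
    and escape: "\<And>C u. length C = m \<Longrightarrow> set C \<subseteq> verts G \<Longrightarrow> u \<in> S \<Longrightarrow> u \<notin> set C \<Longrightarrow>
      \<exists>v\<in>S. player_move G u v \<and> (\<forall>c\<in>set C. \<not> player_move G c v)"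
  shows "\<not> cops_can_win G m"
proof
  assume "cops_can_win G m"
  then obtain \<sigma> where \<sigma>: "cop_strategy G m \<sigma>"
    and win: "\<And>r. robber_play G r \<Longrightarrow> robber_caught \<sigma> r"
    unfolding cops_can_win_def by blast
  define good where "good h v \<longleftrightarrow> v \<in> S \<and> (h = [] \<or> player_move G (last h) v) \<and>
    (\<forall>c\<in>set (\<sigma> h). \<not> player_move G c v)" for h v
  \<comment> \<open>\<open>cop_strategy\<close> constrains the cops only against infinite legal plays of the robber. Staying put
    by default makes \<open>r\<close> legal independently of the existence of good moves, and the legality of the
    cops' moves is then available in the proof that good moves always exist.\<close>
  define next_pos where "next_pos h = (if \<exists>v. good h v then SOME v. good h v else last h)" for h
  have next_pos_good: "good h (next_pos h)" if "\<exists>v. good h v" for h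
    using that someI_ex[of "good h"] by (simp add: next_pos_def)
  define hist where "hist = rec_nat [] (\<lambda>_ h. h @ [next_pos h])"
  define r where "r i = next_pos (hist i)" for i
  define P where "P = cop_positions \<sigma> r"
  have hist: "hist i = map r [0..<i]" for i
    by (induction i) (simp_all add: hist_def r_def)
  then have P: "P i = \<sigma> (hist i)" for i
    by (simp add: P_def cop_positions_def)
  have last_hist: "hist (Suc i) \<noteq> []" "last (hist (Suc i)) = r i" for i
    by (simp_all add: hist)
  have hist_0: "hist 0 = []"
    by (simp add: hist)
  have good_0: "good (hist 0) (r 0)"
    unfolding r_def
  proof (rule next_pos_good)
    show "\<exists>v. good (hist 0) v"
      using start[of "\<sigma> []"] \<sigma> by (auto simp: good_def hist_0 cop_strategy_def)
  qed
  have in_verts: "r i \<in> verts G" for i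
  proof (induction i)
    case 0
    show ?case using good_0 S by (auto simp: good_def)
  next
    case (Suc i)
    show ?case
    proof (cases "\<exists>v. good (hist (Suc i)) v")
      case True
      then show ?thesis
        using next_pos_good S by (auto simp: good_def r_def)
    next
      case False
      then have "r (Suc i) = r i"
        using last_hist by (simp add: r_def next_pos_def)
      then show ?thesis using Suc by simp
    qed
  qed
  have play: "robber_play G r"
    unfolding robber_play_def
  proof (intro conjI allI in_verts)
    fix i
    show "player_move G (r i) (r (Suc i))"
    proof (cases "\<exists>v. good (hist (Suc i)) v")
      case True
      then have "good (hist (Suc i)) (r (Suc i))"
        unfolding r_def by (rule next_pos_good)
      then show ?thesis
        using last_hist by (simp add: good_def)
    next
      case False
      then have "r (Suc i) = r i"
        using last_hist by (simp add: r_def next_pos_def)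
      then show ?thesis using in_verts by (simp add: player_move_def)
    qed
  qed
  have move: "list_all2 (player_move G) (P i) (P (Suc i))" for i
    using \<sigma> play by (simp add: cop_strategy_def P_def)
  have len: "length (P i) = m" for i
  proof (induction i)
    case 0
    show ?case using \<sigma> by (simp add: P hist_0 cop_strategy_def)
  next
    case (Suc i)
    then show ?case using list_all2_lengthD[OF move[of i]] by simp
  qed
  have P_verts: "set (P i) \<subseteq> verts G" for i
    using move[of i] by (auto simp: list_all2_conv_all_nth player_move_def in_set_conv_nth)
  have not_reached: "r i \<notin> set (P (Suc i))" if "good (hist i) (r i)" for i
  proof
    assume "r i \<in> set (P (Suc i))"
    then obtain j where "j < length (P (Suc i))" "P (Suc i) ! j = r i"
      by (auto simp: in_set_conv_nth)
    then have "P i ! j \<in> set (P i)" "player_move G (P i ! j) (r i)"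
      using move[of i] by (auto simp: list_all2_conv_all_nth)
    then show False
      using that by (auto simp: good_def P)
  qed
  have good: "good (hist i) (r i)" for i
  proof (induction i)
    case 0
    show ?case by (rule good_0)
  next
    case (Suc i)
    then have "r i \<in> S" "r i \<notin> set (P (Suc i))"
      using not_reached by (auto simp: good_def)
    then have "\<exists>v. good (hist (Suc i)) v"
      using escape[OF len[of "Suc i"] P_verts] last_hist[of i] by (auto simp: good_def P)
    then show ?case
      unfolding r_def by (rule next_pos_good)
  qed
  have "r i \<notin> set (P i)" for i
    using good[of i] in_verts[of i] by (auto simp: good_def P player_move_def)
  then have "\<not> robber_caught \<sigma> r"
    using not_reached[OF good] by (simp add: robber_caught_def flip: P_def)
  then show False
    using win[OF play] by blast
qed

theorem lemma1:
  fixes G :: "('a, 'b) pre_digraph" and n k t :: nat and D :: real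
  assumes "graph G" and "Digraph_Component.connected G"
    and "card (verts G) = n" and "n > 0" and "n > k" and "t \<ge> 1"
    and "complete_bipartite_free 2 t G"
    and "card {v \<in> verts G. real (out_degree G v) \<ge> D} = n - k"
    and "card {v \<in> verts G. real (out_degree G v) < D} = k"
    and "D > real k"
  shows "real (cop_number G) \<ge> (D - real k) / real t"
proof (rule ccontr)
  interpret graph G by (rule assms(1))
  define m where "m = cop_number G"
  define S where "S = {v \<in> verts G. real (out_degree G v) \<ge> D}"
  define B where "B = {v \<in> verts G. real (out_degree G v) < D}"
  have S: "S \<subseteq> verts G" "card S = n - k" and B: "finite B" "card B = k"
    using assms(8,9) by (auto simp: S_def B_def)
  assume "\<not> ?thesis"
  then have "real (m * t) + real k < D"
    using \<open>t \<ge> 1\<close> by (simp add: m_def field_simps)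
  then have few_cops: "m * t + k < out_degree G u" if "u \<in> S" for u
    using that by (simp add: S_def flip: of_nat_mult of_nat_add)
  have escape: "\<exists>v\<in>S. player_move G u v \<and> (\<forall>c\<in>set C. \<not> player_move G c v)"
    if C: "length C = m" "set C \<subseteq> verts G" and u: "u \<in> S" "u \<notin> set C" for C u
  proof -
    obtain v where v: "u \<rightarrow>\<^bsub>G\<^esub> v" "v \<notin> B" "\<forall>c\<in>set C. \<not> player_move G c v"
      using unthreatened_neighbour[OF assms(1,7) _ u(2) C(2) B(1)] few_cops u S C(1) B(2) by blast
    moreover have "v \<in> S"
      using v(1,2) by (auto simp: S_def B_def not_less)
    moreover have "player_move G u v"
      using v(1) by (auto simp: player_move_def)
    ultimately show ?thesis by blast
  qed
  \<comment> \<open>Otherwise the cops fill \<open>S\<close>, so \<open>n \<le> m * t + k\<close> and no vertex can have the degree that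
    \<open>few_cops\<close> asks for.\<close>
  have unoccupied: "\<exists>u\<in>S. u \<notin> set C" if "length C = m" for C
  proof (rule ccontr)
    assume "\<not> ?thesis"
    then have "card S \<le> card (set C)"
      by (intro card_mono) auto
    also have "\<dots> \<le> m"
      using card_length[of C] that by simp
    also have "\<dots> \<le> m * t"
      using \<open>t \<ge> 1\<close> by simp
    finally have "n \<le> m * t + k"
      using S(2) by simp
    moreover obtain u where "u \<in> S"
      using S(2) \<open>n > k\<close> by fastforce
    moreover have "out_degree G u \<le> n"
      unfolding card_neighbours[symmetric] assms(3)[symmetric] by (intro card_mono) auto
    ultimately show False
      using few_cops[of u] by simp
  qed
  have "\<not> cops_can_win G m"
    using S(1) _ escape
  proof (rule cops_cannot_win_if_evasion_set)
    fix C :: "'a list"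
    assume C: "length C = m" "set C \<subseteq> verts G"
    then obtain u where "u \<in> S" "u \<notin> set C"
      using unoccupied by blast
    then show "\<exists>v\<in>S. \<forall>c\<in>set C. \<not> player_move G c v"
      using escape[OF C] by blast
  qed
  then show False
    using cops_can_win_cop_number[OF assms(1)] by (simp add: m_def)
qed

end
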